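(* Let $$f(\zeta,u)=F(\zeta)+g\,\zeta,$$ where $F$ is an analytic function and $g=g(u)$ is a complex-valued function, and suppose that the corresponding vacuum pp-wave has $\alpha\neq0$ and is of type $(0,2)$, i.e. $d\alpha\wedge d\alpha^*\neq0$ (so that it belongs to the $\mathrm A_{23}$ class). Then the following are equivalent: (i) $d\alpha\wedge d\alpha^*\wedge d\nu=0$; (ii) $\Delta\nu=0$; (iii) $g'(u)=0$.
   Context: Setting. Everything is local, on a small connected coordinate domain with coordinates $(\zeta,\zeta^*,u,v)$, $\zeta$ complex, $u,v$ real; $^*$ (or a bar) is complex conjugation. A (non-flat) vacuum pp-wave is a metric $ds^2=2\,d\zeta\,d\bar\zeta-2\,du\,dv-2(f+\bar f)\,du^2$ with $f=f(\zeta,u)$ complex analytic in $\zeta$, smooth in $u$, $f_{\zeta\zeta}\neq0$ everywhere. Inequalities "$\ne$" are meant at every point, equalities identically. Normalized tetrad and scalars. Let $a=\tfrac14\log f_{\zeta\zeta}$ and $\alpha=e^{a-a^*}(a_\zeta)^*$. If $\alpha\neq0$, write $\zeta=Z(a,u)$, $L=\log Z_a$ (functions of $(a,u)$), and let $\omega^1=(\alpha^* )^{-1}da=e^{a-a^*}(d\zeta-Z_u\,du)$, $\omega^2=(\omega^1)^*$, $\omega^3=e^{a+a^*}du$, $\omega^4=e^{-a-a^*}\big((f+f^*+Z_uZ_u^* )du+dv-Z_u\,d\zeta^*-Z_u^*\,d\zeta\big)$, so the metric is $2\omega^1\omega^2-2\omega^3\omega^4$. Its dual frame $(\delta,\delta^*,\Delta,D)$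 is the null tetrad normalized by $\Psi_4=1$, $\gamma=0$ (Newman–Penrose notation). On functions of $(a,a^*,u)$: $\delta Q=\alpha^*Q_a$, $\delta^*Q=\alpha Q_{a^*}$, $\Delta Q=e^{-a-a^*}Q_u$ ($a,a^*$ fixed), $DQ=0$. The remaining spin coefficients are $\mu=e^{-a-a^*}L_u$ (which vanishes for this class) and $\nu=e^{-a-3a^*}(Z_{uu}+(f_\zeta)^* )$. *)

theory Defs
  imports "HOL-Analysis.Analysis"
begin

text \<open>
  Events carry the coordinates \<open>(\<zeta>, u, v)\<close>, the real 4-dimensional space
  \<open>complex \<times> real \<times> real\<close>; \<open>\<zeta>\<^sup>*\<close> is \<open>cnj \<zeta>\<close>.  A (complexified) 1-form assigns to each event a
  real-linear map from tangent vectors, also of type \<open>event\<close>, to the complex numbers.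
\<close>

type_synonym event = "complex \<times> real \<times> real"
type_synonym one_form = "event \<Rightarrow> event \<Rightarrow> complex"

definition zeta_u_domain :: "event set \<Rightarrow> (complex \<times> real) set" where
  "zeta_u_domain M = (\<lambda>(\<zeta>, u, v). (\<zeta>, u)) ` M"

definition zeta_domain :: "event set \<Rightarrow> complex set" where
  "zeta_domain M = (\<lambda>(\<zeta>, u, v). \<zeta>) ` M"

definition u_domain :: "event set \<Rightarrow> real set" where
  "u_domain M = (\<lambda>(\<zeta>, u, v). u) ` M"


subsection \<open>Exterior calculus\<close>

definition ext_d :: "(event \<Rightarrow> complex) \<Rightarrow> one_form" where
  "ext_d Q p = frechet_derivative Q (at p)"

definition wedge2 :: "one_form \<Rightarrow> one_form \<Rightarrow> event \<Rightarrow> event \<Rightarrow> event \<Rightarrow> complex" where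
  "wedge2 \<theta> \<phi> p X Y = \<theta> p X * \<phi> p Y - \<theta> p Y * \<phi> p X"

definition wedge3 :: "one_form \<Rightarrow> one_form \<Rightarrow> one_form \<Rightarrow> event \<Rightarrow> event \<Rightarrow> event \<Rightarrow> event \<Rightarrow> complex" where
  "wedge3 \<theta> \<phi> \<psi> p X Y W =
     wedge2 \<theta> \<phi> p X Y * \<psi> p W + wedge2 \<theta> \<phi> p Y W * \<psi> p X + wedge2 \<theta> \<phi> p W X * \<psi> p Y"


subsection \<open>Vacuum pp-waves\<close>

text \<open>
  \<open>C\<^sup>k\<close> on an open subset of a finite-dimensional space: the directional derivatives
  are required to be \<open>C\<close>-\<open>(k-1)\<close> for each fixed direction \<open>e\<close>.
\<close>

fun Ck_on :: "nat \<Rightarrow> ('a::euclidean_space \<Rightarrow> 'b::real_normed_vector) \<Rightarrow> 'a set \<Rightarrow> bool" where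
  "Ck_on 0 h S \<longleftrightarrow> continuous_on S h"
| "Ck_on (Suc k) h S \<longleftrightarrow>
     (\<forall>x\<in>S. h differentiable (at x)) \<and> (\<forall>e. Ck_on k (\<lambda>x. frechet_derivative h (at x) e) S)"

definition smooth_on :: "('a::euclidean_space \<Rightarrow> 'b::real_normed_vector) \<Rightarrow> 'a set \<Rightarrow> bool" where
  "smooth_on h S \<longleftrightarrow> (\<forall>k. Ck_on k h S)"

definition f_zeta :: "(complex \<Rightarrow> real \<Rightarrow> complex) \<Rightarrow> complex \<Rightarrow> real \<Rightarrow> complex" where
  "f_zeta f \<zeta> u = deriv (\<lambda>z. f z u) \<zeta>"

definition f_zeta_zeta :: "(complex \<Rightarrow> real \<Rightarrow> complex) \<Rightarrow> complex \<Rightarrow> real \<Rightarrow> complex" where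
  "f_zeta_zeta f \<zeta> u = deriv (\<lambda>z. f_zeta f z u) \<zeta>"

text \<open>The bilinear form of \<open>ds\<^sup>2 = 2 d\<zeta> d\<zeta>\<^sup>* - 2 du dv - 2 (f + f\<^sup>*) du\<^sup>2\<close>.\<close>

definition pp_metric ::
    "(complex \<Rightarrow> real \<Rightarrow> complex) \<Rightarrow> event \<Rightarrow> event \<Rightarrow> event \<Rightarrow> complex" where
  "pp_metric f = (\<lambda>(\<zeta>, u, v) (d\<zeta>, du, dv) (d\<zeta>', du', dv').
     d\<zeta> * cnj d\<zeta>' + cnj d\<zeta> * d\<zeta>' - of_real (du * dv' + dv * du')
     - 2 * (f \<zeta> u + cnj (f \<zeta> u)) * of_real (du * du'))"

text \<open>
  \<open>f\<close> is complex analytic in \<open>\<zeta>\<close> for each \<open>u\<close>, jointly smooth in \<open>(\<zeta>, u)\<close>, and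
  \<open>f\<^sub>\<zeta>\<^sub>\<zeta> \<noteq> 0\<close> everywhere (the pp-wave is not flat).  Only the values of \<open>f\<close> at pairs \<open>(\<zeta>, u)\<close>
  that occur in \<open>M\<close> matter.
\<close>

definition vacuum_pp_wave :: "event set \<Rightarrow> (complex \<Rightarrow> real \<Rightarrow> complex) \<Rightarrow> bool" where
  "vacuum_pp_wave M f \<longleftrightarrow>
     open M \<and> connected M \<and> M \<noteq> {} \<and>
     (\<forall>u. (\<lambda>\<zeta>. f \<zeta> u) analytic_on {\<zeta>. (\<zeta>, u) \<in> zeta_u_domain M}) \<and>
     smooth_on (\<lambda>(\<zeta>, u). f \<zeta> u) (zeta_u_domain M) \<and>
     (\<forall>(\<zeta>, u) \<in> zeta_u_domain M. f_zeta_zeta f \<zeta> u \<noteq> 0)"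


subsection \<open>Normalized tetrad and scalars\<close>

text \<open>\<open>a = \<onequarter> log f\<^sub>\<zeta>\<^sub>\<zeta>\<close>, for an arbitrary continuous branch of the logarithm.\<close>

definition quarter_log_branch ::
    "event set \<Rightarrow> (complex \<Rightarrow> real \<Rightarrow> complex) \<Rightarrow> (complex \<Rightarrow> real \<Rightarrow> complex) \<Rightarrow> bool" where
  "quarter_log_branch M f a \<longleftrightarrow>
     continuous_on (zeta_u_domain M) (\<lambda>(\<zeta>, u). a \<zeta> u) \<and>
     (\<forall>(\<zeta>, u) \<in> zeta_u_domain M. exp (4 * a \<zeta> u) = f_zeta_zeta f \<zeta> u)"

definition pp_alpha :: "(complex \<Rightarrow> real \<Rightarrow> complex) \<Rightarrow> event \<Rightarrow> complex" where
  "pp_alpha a = (\<lambda>(\<zeta>, u, v). exp (a \<zeta> u - cnj (a \<zeta> u)) * cnj (deriv (\<lambda>z. a z u) \<zeta>))"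

text \<open>
  \<open>\<zeta> = Z(a, u)\<close>.  Where \<open>a\<^sub>\<zeta> \<noteq> 0\<close>, the map \<open>(\<zeta>, u) \<mapsto> (a, u)\<close> is open, so the derivatives of \<open>Z\<close> at
  points of its image do not depend on the values of \<open>Z\<close> elsewhere.
\<close>

definition zeta_inversion ::
    "event set \<Rightarrow> (complex \<Rightarrow> real \<Rightarrow> complex) \<Rightarrow> (complex \<Rightarrow> real \<Rightarrow> complex) \<Rightarrow> bool" where
  "zeta_inversion M a Z \<longleftrightarrow> (\<forall>(\<zeta>, u) \<in> zeta_u_domain M. Z (a \<zeta> u) u = \<zeta>)"

definition Z_u :: "(complex \<Rightarrow> real \<Rightarrow> complex) \<Rightarrow> complex \<Rightarrow> real \<Rightarrow> complex" where
  "Z_u Z b u = vector_derivative (\<lambda>t. Z b t) (at u)"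

definition Z_uu :: "(complex \<Rightarrow> real \<Rightarrow> complex) \<Rightarrow> complex \<Rightarrow> real \<Rightarrow> complex" where
  "Z_uu Z b u = vector_derivative (\<lambda>t. Z_u Z b t) (at u)"

text \<open>
  The null coframe.  Differentiating \<open>Z (a \<zeta> u) u = \<zeta>\<close> shows that \<open>\<omega>\<^sup>1\<close> is also \<open>da\<close> divided by \<open>\<alpha>\<^sup>*\<close>.
\<close>

definition omega1 ::
    "(complex \<Rightarrow> real \<Rightarrow> complex) \<Rightarrow> (complex \<Rightarrow> real \<Rightarrow> complex) \<Rightarrow> one_form" where
  "omega1 a Z = (\<lambda>(\<zeta>, u, v) (d\<zeta>, du, dv).
     exp (a \<zeta> u - cnj (a \<zeta> u)) * (d\<zeta> - Z_u Z (a \<zeta> u) u * of_real du))"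

definition omega2 ::
    "(complex \<Rightarrow> real \<Rightarrow> complex) \<Rightarrow> (complex \<Rightarrow> real \<Rightarrow> complex) \<Rightarrow> one_form" where
  "omega2 a Z p X = cnj (omega1 a Z p X)"

definition omega3 :: "(complex \<Rightarrow> real \<Rightarrow> complex) \<Rightarrow> one_form" where
  "omega3 a = (\<lambda>(\<zeta>, u, v) (d\<zeta>, du, dv). exp (a \<zeta> u + cnj (a \<zeta> u)) * of_real du)"

definition omega4 ::
    "(complex \<Rightarrow> real \<Rightarrow> complex) \<Rightarrow> (complex \<Rightarrow> real \<Rightarrow> complex) \<Rightarrow>
     (complex \<Rightarrow> real \<Rightarrow> complex) \<Rightarrow> one_form" where
  "omega4 f a Z = (\<lambda>(\<zeta>, u, v) (d\<zeta>, du, dv).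
     exp (- a \<zeta> u - cnj (a \<zeta> u)) *
       ((f \<zeta> u + cnj (f \<zeta> u) + Z_u Z (a \<zeta> u) u * cnj (Z_u Z (a \<zeta> u) u)) * of_real du
        + of_real dv - Z_u Z (a \<zeta> u) u * cnj d\<zeta> - cnj (Z_u Z (a \<zeta> u) u) * d\<zeta>))"

lemma pp_metric_null_coframe:
  "pp_metric f p X Y =
     omega1 a Z p X * omega2 a Z p Y + omega2 a Z p X * omega1 a Z p Y
     - omega3 a p X * omega4 f a Z p Y - omega4 f a Z p X * omega3 a p Y"
proof -
  obtain \<zeta> u v where p: "p = (\<zeta>, u, v)" by (cases p)
  obtain z r s where X: "X = (z, r, s)" by (cases X)
  obtain z' r' s' where Y: "Y = (z', r', s')" by (cases Y)
  define w where "w = Z_u Z (a \<zeta> u) u"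
  define E where "E = exp (a \<zeta> u - cnj (a \<zeta> u))"
  define H where "H = exp (a \<zeta> u + cnj (a \<zeta> u))"
  define K where "K = exp (- a \<zeta> u - cnj (a \<zeta> u))"
  have E: "E * cnj E = 1" and H: "H * K = 1"
    by (simp_all add: E_def H_def K_def exp_cnj flip: exp_add)
  have 1: "(E * x) * (cnj E * y) = x * y" "(cnj E * x) * (E * y) = x * y"
    "(H * x) * (K * y) = x * y" "(K * x) * (H * y) = x * y" for x y
    using E H by algebra+
  show ?thesis
    unfolding p X Y omega1_def omega2_def omega3_def omega4_def pp_metric_def prod.case
      w_def[symmetric] E_def[symmetric] H_def[symmetric] K_def[symmetric] complex_cnj_mult 1
    by (simp add: algebra_simps)
qed

text \<open>
  The real vector field \<open>\<Delta>\<close> of the frame \<open>(\<delta>, \<delta>\<^sup>*, \<Delta>, D)\<close> dual to \<open>(\<omega>\<^sup>1, \<omega>\<^sup>2, \<omega>\<^sup>3, \<omega>\<^sup>4)\<close>; as a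
  derivation, \<open>\<Delta> Q\<close> is \<open>dQ\<close> evaluated on it.
\<close>

definition Delta_vector ::
    "(complex \<Rightarrow> real \<Rightarrow> complex) \<Rightarrow> (complex \<Rightarrow> real \<Rightarrow> complex) \<Rightarrow>
     (complex \<Rightarrow> real \<Rightarrow> complex) \<Rightarrow> event \<Rightarrow> event" where
  "Delta_vector f a Z p =
     (THE X. omega1 a Z p X = 0 \<and> omega2 a Z p X = 0 \<and> omega3 a p X = 1 \<and> omega4 f a Z p X = 0)"

definition NP_Delta ::
    "(complex \<Rightarrow> real \<Rightarrow> complex) \<Rightarrow> (complex \<Rightarrow> real \<Rightarrow> complex) \<Rightarrow>
     (complex \<Rightarrow> real \<Rightarrow> complex) \<Rightarrow> (event \<Rightarrow> complex) \<Rightarrow> event \<Rightarrow> complex" where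
  "NP_Delta f a Z Q p = ext_d Q p (Delta_vector f a Z p)"

lemma Delta_vector_eq:
  fixes a Z f :: "complex \<Rightarrow> real \<Rightarrow> complex" and \<zeta> :: complex and u v :: real
  defines "k \<equiv> exp (- 2 * Re (a \<zeta> u))" and "w \<equiv> Z_u Z (a \<zeta> u) u"
  shows "Delta_vector f a Z (\<zeta>, u, v) =
           (of_real k * w, k, k * ((cmod w)\<^sup>2 - 2 * Re (f \<zeta> u)))"
  unfolding Delta_vector_def
proof (rule the_equality)
  have e: "exp (a \<zeta> u + cnj (a \<zeta> u)) = of_real (inverse k)"
    unfolding k_def complex_add_cnj exp_of_real by (simp flip: exp_minus)
  have k: "k \<noteq> 0" by (simp add: k_def)
  have wc: "w * cnj w = of_real ((cmod w)\<^sup>2)"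
    by (metis complex_norm_square)
  have fc: "f \<zeta> u + cnj (f \<zeta> u) = of_real (2 * Re (f \<zeta> u))"
    by (rule complex_add_cnj)
  show "omega1 a Z (\<zeta>, u, v) (of_real k * w, k, k * ((cmod w)\<^sup>2 - 2 * Re (f \<zeta> u))) = 0 \<and>
        omega2 a Z (\<zeta>, u, v) (of_real k * w, k, k * ((cmod w)\<^sup>2 - 2 * Re (f \<zeta> u))) = 0 \<and>
        omega3 a (\<zeta>, u, v) (of_real k * w, k, k * ((cmod w)\<^sup>2 - 2 * Re (f \<zeta> u))) = 1 \<and>
        omega4 f a Z (\<zeta>, u, v) (of_real k * w, k, k * ((cmod w)\<^sup>2 - 2 * Re (f \<zeta> u))) = 0"
    using k
    by (simp add: omega1_def omega2_def omega3_def omega4_def e fc wc flip: w_def of_real_add)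
       (simp add: algebra_simps wc)
next
  fix X assume X: "omega1 a Z (\<zeta>, u, v) X = 0 \<and> omega2 a Z (\<zeta>, u, v) X = 0 \<and>
    omega3 a (\<zeta>, u, v) X = 1 \<and> omega4 f a Z (\<zeta>, u, v) X = 0"
  obtain z r s where X': "X = (z, r, s)" by (cases X)
  have e: "exp (a \<zeta> u + cnj (a \<zeta> u)) = of_real (inverse k)"
    unfolding k_def complex_add_cnj exp_of_real by (simp flip: exp_minus)
  have k: "k \<noteq> 0" by (simp add: k_def)
  have wc: "w * cnj w = of_real ((cmod w)\<^sup>2)"
    by (metis complex_norm_square)
  have fc: "f \<zeta> u + cnj (f \<zeta> u) = of_real (2 * Re (f \<zeta> u))"
    by (rule complex_add_cnj)
  have "complex_of_real (inverse k * r) = of_real 1"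
    using X by (simp add: X' omega3_def e)
  then have r: "r = k"
    using k by (simp only: of_real_eq_iff) (simp add: field_simps)
  have z: "z = of_real k * w"
    using X by (simp add: X' omega1_def r flip: w_def)
  have "complex_of_real s = of_real (k * ((cmod w)\<^sup>2 - 2 * Re (f \<zeta> u)))"
  proof -
    have wc': "w * (cnj w * c) = of_real ((cmod w)\<^sup>2) * c" for c
      by (simp add: wc flip: mult.assoc)
    have "omega4 f a Z (\<zeta>, u, v) (z, r, s) = 0"
      using X X' by simp
    then show ?thesis
      by (simp add: omega4_def r z fc wc flip: w_def) (simp add: algebra_simps wc')
  qed
  then show "X = (of_real k * w, k, k * ((cmod w)\<^sup>2 - 2 * Re (f \<zeta> u)))"
    by (simp only: of_real_eq_iff X' r z)
qed

text \<open>
  The Newman-Penrose spin coefficient \<open>\<nu>\<close>, i.e. the metric product of \<open>\<delta>\<^sup>*\<close> with the covariant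
  derivative of \<open>\<Delta>\<close> along itself; the formula is its value in the tetrad above, and involves the
  Christoffel symbol \<open>(f\<^sub>\<zeta>)\<^sup>*\<close> (upper index \<open>\<zeta>\<close>, lower indices \<open>u u\<close>) of the metric.
\<close>

definition pp_nu ::
    "(complex \<Rightarrow> real \<Rightarrow> complex) \<Rightarrow> (complex \<Rightarrow> real \<Rightarrow> complex) \<Rightarrow>
     (complex \<Rightarrow> real \<Rightarrow> complex) \<Rightarrow> event \<Rightarrow> complex" where
  "pp_nu f a Z = (\<lambda>(\<zeta>, u, v).
     exp (- a \<zeta> u - 3 * cnj (a \<zeta> u)) * (Z_uu Z (a \<zeta> u) u + cnj (f_zeta f \<zeta> u)))"

text \<open>\<open>d\<alpha> \<and> d\<alpha>\<^sup>* \<noteq> 0\<close> at every point.\<close>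

definition type_0_2 :: "event set \<Rightarrow> (complex \<Rightarrow> real \<Rightarrow> complex) \<Rightarrow> bool" where
  "type_0_2 M a \<longleftrightarrow>
     (\<forall>p\<in>M. \<exists>X Y. wedge2 (ext_d (pp_alpha a)) (ext_d (\<lambda>q. cnj (pp_alpha a q))) p X Y \<noteq> 0)"

end

theory Submission
  imports Defs "HOL-Complex_Analysis.Complex_Analysis"
begin

text \<open>
  Since \<open>f\<^sub>\<zeta>\<^sub>\<zeta> = F''\<close> does not involve \<open>u\<close>, the continuous branch \<open>a\<close> is locally a holomorphic function
  of \<open>\<zeta>\<close> alone.  Hence \<open>Z\<^sub>u\<close> and \<open>Z\<^sub>u\<^sub>u\<close> vanish at the relevant points, \<open>\<alpha>\<close> is locally a function of
  \<open>\<zeta>\<close>, and \<open>\<nu> = exp (- a - 3 a\<^sup>*) (F' + g)\<^sup>*\<close> depends on \<open>u\<close> only through \<open>g\<close>.  As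
  \<open>d\<alpha> \<and> d\<alpha>\<^sup>* \<noteq> 0\<close> already exhausts the \<open>\<zeta>\<close>-directions, each of the three conditions says at a
  point that \<open>\<partial>\<^sub>u \<nu>\<close>, a nonzero multiple of the conjugate of \<open>g'\<close>, vanishes there.
\<close>

section \<open>Product neighbourhoods and the \<zeta>-derivatives of \<open>f\<close>\<close>

text \<open>Supplies boxes on which \<zeta> and \<open>u\<close> vary independently; only there does
  "independent of \<open>u\<close>" have a local meaning.\<close>

lemma zeta_u_domain_box:
  assumes "open M" "(\<zeta>, u) \<in> zeta_u_domain M"
  obtains U V where "open U" "open V" "\<zeta> \<in> U" "u \<in> V" "U \<times> V \<subseteq> zeta_u_domain M"
proof -
  from assms(2) obtain v where "(\<zeta>, u, v) \<in> M"
    by (auto simp: zeta_u_domain_def)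
  with assms(1) obtain U T where "open U" "open T" "(\<zeta>, u, v) \<in> U \<times> T" "U \<times> T \<subseteq> M"
    by (rule open_prod_elim)
  then have U: "open U" "\<zeta> \<in> U" "open T" "(u, v) \<in> T" "U \<times> T \<subseteq> M"
    by auto
  from U(3,4) obtain V W where "open V" "open W" "(u, v) \<in> V \<times> W" "V \<times> W \<subseteq> T"
    by (rule open_prod_elim)
  then have V: "open V" "u \<in> V" "v \<in> W" "V \<times> W \<subseteq> T"
    by auto
  have "U \<times> V \<subseteq> zeta_u_domain M"
  proof clarify
    fix x y assume "x \<in> U" "y \<in> V"
    with U V have "(x, y, v) \<in> M" by auto
    then show "(x, y) \<in> zeta_u_domain M"
      unfolding zeta_u_domain_def by force
  qed
  with U V that show thesis by blast
qed

lemma zeta_u_domain_imp_zeta_domain: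
  "(\<zeta>, u) \<in> zeta_u_domain M \<Longrightarrow> \<zeta> \<in> zeta_domain M"
  unfolding zeta_u_domain_def zeta_domain_def by force

lemma f_zeta_eq:
  assumes "open U" "\<zeta> \<in> U" "F analytic_on U"
    and "\<And>z. z \<in> U \<Longrightarrow> f z u = F z + c * z"
  shows "f_zeta f \<zeta> u = deriv F \<zeta> + c"
proof -
  have "F field_differentiable at \<zeta>"
    using assms(2,3) analytic_on_imp_differentiable_at by blast
  then have "((\<lambda>z. F z + c * z) has_field_derivative deriv F \<zeta> + c) (at \<zeta>)"
    by (auto intro!: derivative_eq_intros simp: field_differentiable_derivI)
  then have "((\<lambda>z. f z u) has_field_derivative deriv F \<zeta> + c) (at \<zeta>)"
    by (rule has_field_derivative_transform_within_open) (use assms in auto)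
  then show ?thesis
    unfolding f_zeta_def by (rule DERIV_imp_deriv)
qed

lemma f_zeta_zeta_eq:
  assumes "open U" "\<zeta> \<in> U" "F analytic_on U"
    and "\<And>z. z \<in> U \<Longrightarrow> f z u = F z + c * z"
  shows "f_zeta_zeta f \<zeta> u = deriv (deriv F) \<zeta>"
proof -
  have "deriv F field_differentiable at \<zeta>"
    using assms(2,3) analytic_on_imp_differentiable_at analytic_deriv by blast
  then have "((\<lambda>z. deriv F z + c) has_field_derivative deriv (deriv F) \<zeta>) (at \<zeta>)"
    by (auto intro!: derivative_eq_intros simp: field_differentiable_derivI)
  then have "((\<lambda>z. f_zeta f z u) has_field_derivative deriv (deriv F) \<zeta>) (at \<zeta>)"
    by (rule has_field_derivative_transform_within_open[where S=U])
       (use assms f_zeta_eq[of U _ F f u c] in auto)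
  then show ?thesis
    unfolding f_zeta_zeta_def by (rule DERIV_imp_deriv)
qed

section \<open>The logarithm branch and its inversion\<close>

text \<open>Near the base point the exponent \<open>4 * a\<close> moves by less than
  \<open>pi\<close>, so the principal logarithm of \<open>H \<zeta> / H \<zeta>0\<close> recovers
  the change exactly. The resulting formula is holomorphic in \<zeta> and contains no
  \<open>u\<close>.\<close>

lemma local_log_branch:
  fixes H :: "complex \<Rightarrow> complex" and a :: "complex \<Rightarrow> real \<Rightarrow> complex"
  assumes "open N" "(\<zeta>0, u0) \<in> N"
    and cont: "continuous_on N (\<lambda>(\<zeta>, u). a \<zeta> u)"
    and exp_eq: "\<And>\<zeta> u. (\<zeta>, u) \<in> N \<Longrightarrow> exp (4 * a \<zeta> u) = H \<zeta>"
    and H: "H analytic_on fst ` N"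
  obtains U V A where "open U" "open V" "\<zeta>0 \<in> U" "u0 \<in> V" "U \<times> V \<subseteq> N"
    "A holomorphic_on U" "\<And>\<zeta> u. \<zeta> \<in> U \<Longrightarrow> u \<in> V \<Longrightarrow> a \<zeta> u = A \<zeta>"
proof -
  \<comment> \<open>The radius \<open>pi / 4\<close> becomes \<open>pi\<close> after the factor 4,
    which keeps \<open>w\<close> below inside the strip where \<open>Ln\<close> inverts
    \<open>exp\<close>.\<close>
  define P where "P = N \<inter> (\<lambda>(\<zeta>, u). a \<zeta> u) -` ball (a \<zeta>0 u0) (pi / 4)"
  have "open P"
    unfolding P_def using cont \<open>open N\<close> by (intro continuous_open_preimage) auto
  moreover have "(\<zeta>0, u0) \<in> P"
    using assms(2) by (simp add: P_def)
  ultimately obtain U V where UV: "open U" "open V" "\<zeta>0 \<in> U" "u0 \<in> V" "U \<times> V \<subseteq> P"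
    by (elim open_prod_elim) auto
  have branch: "a \<zeta> u = a \<zeta>0 u0 + Ln (H \<zeta> / H \<zeta>0) / 4" "H \<zeta> / H \<zeta>0 \<notin> \<real>\<^sub>\<le>\<^sub>0"
    if "\<zeta> \<in> U" "u \<in> V" for \<zeta> u
  proof -
    have mem: "(\<zeta>, u) \<in> P"
      using UV that by auto
    define w where "w = 4 * (a \<zeta> u - a \<zeta>0 u0)"
    have "cmod w < pi"
      unfolding w_def norm_mult using mem by (simp add: P_def dist_norm norm_minus_commute)
    then have im: "\<bar>Im w\<bar> < pi"
      using abs_Im_le_cmod le_less_trans by blast
    have w: "exp w = H \<zeta> / H \<zeta>0"
      using exp_eq[of \<zeta> u] exp_eq[of \<zeta>0 u0] mem assms(2)
      by (simp add: P_def w_def right_diff_distrib exp_diff)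
    have "Ln (exp w) = w"
      using im by (intro Ln_exp) auto
    with w show "a \<zeta> u = a \<zeta>0 u0 + Ln (H \<zeta> / H \<zeta>0) / 4"
      by (simp add: w_def diff_divide_distrib)
    \<comment> \<open>Holomorphy of \<open>Ln\<close> requires staying off the branch cut. On the
      cut \<open>Ln\<close> has imaginary part \<open>pi\<close>, against the strict bound on
      \<open>Im w\<close>.\<close>
    show "H \<zeta> / H \<zeta>0 \<notin> \<real>\<^sub>\<le>\<^sub>0"
    proof
      assume "H \<zeta> / H \<zeta>0 \<in> \<real>\<^sub>\<le>\<^sub>0"
      moreover have "H \<zeta> / H \<zeta>0 \<noteq> 0"
        using w by (metis exp_not_eq_zero)
      ultimately have "Im (Ln (H \<zeta> / H \<zeta>0)) = pi"
        by (metis Im_Ln_eq_pi complex_nonpos_Reals_iff less_le complex_eq_iff zero_complex.sel)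
      with \<open>Ln (exp w) = w\<close> w im show False by simp
    qed
  qed
  have "H holomorphic_on U"
    using UV by (intro analytic_imp_holomorphic analytic_on_subset[OF H]) (force simp: P_def)
  moreover have "H \<zeta>0 \<noteq> 0"
    using exp_eq[OF assms(2)] by (metis exp_not_eq_zero)
  ultimately have "(\<lambda>\<zeta>. a \<zeta>0 u0 + Ln (H \<zeta> / H \<zeta>0) / 4) holomorphic_on U"
    using branch(2) UV by (intro holomorphic_intros) auto
  then show thesis
    using UV by (intro that[OF UV(1-4) _ _ branch(1)]) (auto simp: P_def)
qed

lemma Z_u_zero:
  assumes "open V" "u \<in> V" "\<And>t. t \<in> V \<Longrightarrow> Z b t = \<zeta>"
  shows "Z_u Z b u = 0" "Z_uu Z b u = 0"
proof -
  \<comment> \<open>Vanishing at \<open>u\<close> alone would not control \<open>Z_uu\<close>, which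
    differentiates \<open>Z_u\<close> once more; hence the claim on all of \<open>V\<close>.\<close>
  have *: "Z_u Z b t = 0" if "t \<in> V" for t
  proof -
    have "((\<lambda>t. Z b t) has_vector_derivative 0) (at t)"
      by (rule has_vector_derivative_transform_within_open[OF has_vector_derivative_const[of \<zeta>]])
         (use assms that in auto)
    then show ?thesis
      unfolding Z_u_def by (rule vector_derivative_at)
  qed
  then show "Z_u Z b u = 0"
    using assms(2) by blast
  have "((\<lambda>t. Z_u Z b t) has_vector_derivative 0) (at u)"
    by (rule has_vector_derivative_transform_within_open[OF has_vector_derivative_const[of 0]])
       (use assms * in auto)
  then show "Z_uu Z b u = 0"
    unfolding Z_uu_def by (rule vector_derivative_at)
qed

section \<open>Exterior algebra and local differentials\<close>

text \<open>The three forms are pulled back from the complex plane, which has real dimension 2 and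
  so carries no nonzero alternating 3-form.\<close>

lemma wedge3_linear_complex:
  fixes h k m :: "complex \<Rightarrow> complex"
  assumes "linear h" "linear k" "linear m"
    and "\<And>X. \<theta> p X = h (fst X)" "\<And>X. \<phi> p X = k (fst X)" "\<And>X. \<psi> p X = m (fst X)"
  shows "wedge3 \<theta> \<phi> \<psi> p X Y W = 0"
proof -
  \<comment> \<open>Expanding over the real basis \<open>1\<close>, \<open>\<i>\<close> turns the
    claim into a polynomial identity.\<close>
  have coords: "l z = of_real (Re z) * l 1 + of_real (Im z) * l \<i>" if "linear l"
    for l :: "complex \<Rightarrow> complex" and z
  proof -
    have "l z = l (Re z *\<^sub>R 1 + Im z *\<^sub>R \<i>)"
      by (rule arg_cong[where f = l]) (simp add: complex_eq_iff)
    also have "\<dots> = Re z *\<^sub>R l 1 + Im z *\<^sub>R l \<i>"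
      using that by (simp add: linear_add linear_scale)
    finally show ?thesis
      by (simp add: scaleR_conv_of_real)
  qed
  show ?thesis
    unfolding wedge3_def wedge2_def assms(4-6)
      coords[OF assms(1), of "fst _"] coords[OF assms(2), of "fst _"] coords[OF assms(3), of "fst _"]
    by algebra
qed

text \<open>A differential depends only on values near the point, so a scalar may be replaced there
  by its local expression.\<close>

lemma ext_d_eqI:
  fixes Q :: "event \<Rightarrow> complex"
  assumes "open S" "p \<in> S" "(R has_derivative D) (at p)" "\<And>q. q \<in> S \<Longrightarrow> Q q = R q"
  shows "ext_d Q p = D"
proof -
  have "(Q has_derivative D) (at p)"
    by (rule has_derivative_transform_within_open[OF assms(3,1,2)]) (use assms in auto)
  then show ?thesis
    unfolding ext_d_def by (metis frechet_derivative_at)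
qed

text \<open>Regularity is assumed for \<open>f\<close> and not for \<open>g\<close>, so
  differentiability of \<open>g\<close> is obtained by solving for it at a fixed nonzero \<zeta>;
  \<open>c\<close> plays the part of \<open>F \<zeta>\<close>.\<close>

lemma shear_vector_derivative:
  fixes f :: "complex \<Rightarrow> real \<Rightarrow> complex"
  assumes f: "(\<lambda>(\<zeta>, u). f \<zeta> u) differentiable at (\<zeta>, u)"
    and "open V" "u \<in> V" "\<zeta> \<noteq> 0" "\<And>t. t \<in> V \<Longrightarrow> f \<zeta> t = c + g t * \<zeta>"
  shows "\<exists>g'. (g has_vector_derivative g') (at u)"
proof -
  have "((\<lambda>(\<zeta>, u). f \<zeta> u) \<circ> (\<lambda>t. (\<zeta>, t))) differentiable at u"
    using f by (intro differentiable_chain_at) (auto intro!: derivative_intros simp: differentiable_def)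
  then have "(\<lambda>t. (f \<zeta> t - c) / \<zeta>) differentiable at u"
    using \<open>\<zeta> \<noteq> 0\<close> by (auto simp: o_def intro!: derivative_intros)
  then obtain g' where "((\<lambda>t. (f \<zeta> t - c) / \<zeta>) has_vector_derivative g') (at u)"
    using vector_derivative_works by blast
  then have "(g has_vector_derivative g') (at u)"
    by (rule has_vector_derivative_transform_within_open) (use assms in auto)
  then show ?thesis by blast
qed

lemma differentiable_complex_exp:
  fixes h :: "'a::real_normed_vector \<Rightarrow> complex"
  assumes "h differentiable at x"
  shows "(\<lambda>x. exp (h x)) differentiable at x"
proof -
  have "(exp :: complex \<Rightarrow> complex) differentiable at (h x)"
    using DERIV_exp field_differentiable_def field_differentiable_imp_differentiable by blast
  then show ?thesis
    using assms differentiable_compose by blast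
qed

lemma differentiable_cnj:
  "h differentiable at x \<Longrightarrow> (\<lambda>x. cnj (h x)) differentiable at x"
  unfolding differentiable_def by (auto intro: has_derivative_cnj)

text \<open>The second equation, free of \<open>u\<close>, is what lets
  \<open>local_log_branch\<close> be applied with \<open>H = F''\<close>.\<close>

lemma f_zeta_eq_domain:
  assumes "open M" "F analytic_on zeta_domain M"
    and "\<And>\<zeta> u. (\<zeta>, u) \<in> zeta_u_domain M \<Longrightarrow> f \<zeta> u = F \<zeta> + g u * \<zeta>"
    and "(\<zeta>, u) \<in> zeta_u_domain M"
  shows "f_zeta f \<zeta> u = deriv F \<zeta> + g u" "f_zeta_zeta f \<zeta> u = deriv (deriv F) \<zeta>"
proof -
  obtain U V where UV: "open U" "open V" "\<zeta> \<in> U" "u \<in> V" "U \<times> V \<subseteq> zeta_u_domain M"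
    using zeta_u_domain_box[OF assms(1,4)] .
  then have "F analytic_on U"
    using zeta_u_domain_imp_zeta_domain by (intro analytic_on_subset[OF assms(2)]) blast
  then show "f_zeta f \<zeta> u = deriv F \<zeta> + g u" "f_zeta_zeta f \<zeta> u = deriv (deriv F) \<zeta>"
    using UV by (auto intro!: f_zeta_eq[of U] f_zeta_zeta_eq[where U = U and c = "g u"] assms(3))
qed

lemma open_zeta_u_domain:
  assumes "open M"
  shows "open (zeta_u_domain M)"
proof (subst open_subopen, rule ballI)
  fix x assume "x \<in> zeta_u_domain M"
  moreover obtain \<zeta> u where x: "x = (\<zeta>, u)" by (cases x)
  ultimately obtain U V where "open U" "open V" "\<zeta> \<in> U" "u \<in> V" "U \<times> V \<subseteq> zeta_u_domain M"
    using zeta_u_domain_box[OF assms] by metis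
  then show "\<exists>T. open T \<and> x \<in> T \<and> T \<subseteq> zeta_u_domain M"
    using open_Times x by blast
qed

section \<open>The three differentials at one event\<close>

text \<open>Isolates all that the equivalences need: the differentials of \<alpha> and its conjugate
  see only the \<zeta>-component, while that of \<nu> has one further term, along \<open>du\<close>.
  Its coefficient contains \<open>c\<close>, the exponential prefactor of \<nu>, hence
  nonzero.\<close>

lemma pp_wave_pointwise:
  fixes M :: "event set" and f a Z :: "complex \<Rightarrow> real \<Rightarrow> complex"
  assumes pp_wave: "vacuum_pp_wave M f"
    and F_analytic: "F analytic_on zeta_domain M"
    and f_eq: "\<And>\<zeta> u. (\<zeta>, u) \<in> zeta_u_domain M \<Longrightarrow> f \<zeta> u = F \<zeta> + g u * \<zeta>"
    and a_branch: "quarter_log_branch M f a"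
    and Z_inv: "zeta_inversion M a Z"
    and p: "(\<zeta>0, u0, v0) \<in> M"
    and g': "(g has_vector_derivative g') (at u0)"
  obtains h k m c where "linear h" "linear k" "linear m" "c \<noteq> 0"
    "\<And>X. ext_d (pp_alpha a) (\<zeta>0, u0, v0) X = h (fst X)"
    "\<And>X. ext_d (\<lambda>q. cnj (pp_alpha a q)) (\<zeta>0, u0, v0) X = k (fst X)"
    "\<And>X. ext_d (pp_nu f a Z) (\<zeta>0, u0, v0) X
           = m (fst X) + of_real (fst (snd X)) * (c * cnj g')"
    "Z_u Z (a \<zeta>0 u0) u0 = 0"
proof -
  let ?N = "zeta_u_domain M"
  have M: "open M"
    using pp_wave by (simp add: vacuum_pp_wave_def)
  then have N: "open ?N" "(\<zeta>0, u0) \<in> ?N"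
    using p by (simp add: open_zeta_u_domain) (use p in \<open>force simp: zeta_u_domain_def\<close>)
  have F'': "deriv (deriv F) analytic_on zeta_domain M"
    by (intro analytic_deriv F_analytic)
  note fz = f_zeta_eq_domain[where f = f and g = g, OF M F_analytic f_eq]
  obtain U V A where UV: "open U" "open V" "\<zeta>0 \<in> U" "u0 \<in> V" "U \<times> V \<subseteq> ?N"
    and A: "A holomorphic_on U" "\<And>\<zeta> u. \<zeta> \<in> U \<Longrightarrow> u \<in> V \<Longrightarrow> a \<zeta> u = A \<zeta>"
  proof (rule local_log_branch[OF N, of a "deriv (deriv F)"])
    show "continuous_on ?N (\<lambda>(\<zeta>, u). a \<zeta> u)"
      using a_branch by (simp add: quarter_log_branch_def)
    show "exp (4 * a \<zeta> u) = deriv (deriv F) \<zeta>" if "(\<zeta>, u) \<in> ?N" for \<zeta> u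
      using a_branch that fz(2)[of \<zeta> u] by (auto simp: quarter_log_branch_def)
    show "deriv (deriv F) analytic_on fst ` ?N"
      using zeta_u_domain_imp_zeta_domain by (intro analytic_on_subset[OF F'']) auto
  qed blast
  \<comment> \<open>Since \<open>a \<zeta> t = a \<zeta> u\<close> for all \<open>t\<close> in
    \<open>V\<close>, the inversion property at each such \<open>t\<close> makes
    \<open>Z (a \<zeta> u)\<close> constantly \<zeta> on \<open>V\<close>.\<close>
  have Z: "Z_u Z (a \<zeta> u) u = 0" "Z_uu Z (a \<zeta> u) u = 0" if "\<zeta> \<in> U" "u \<in> V" for \<zeta> u
  proof -
    have "Z (a \<zeta> u) t = \<zeta>" if "t \<in> V" for t
      using Z_inv A(2) UV(5) that \<open>\<zeta> \<in> U\<close> \<open>u \<in> V\<close> by (fastforce simp: zeta_inversion_def)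
    then show "Z_u Z (a \<zeta> u) u = 0" "Z_uu Z (a \<zeta> u) u = 0"
      using Z_u_zero[OF UV(2) \<open>u \<in> V\<close>] by auto
  qed
  \<comment> \<open>The coordinate \<open>v\<close> is left free because \<alpha> and \<nu> do not
    involve it.\<close>
  define S :: "event set" where "S = U \<times> V \<times> UNIV"
  have S: "open S" "(\<zeta>0, u0, v0) \<in> S"
    using UV by (auto simp: S_def open_Times)
  have dA: "A differentiable at \<zeta>0" "deriv A differentiable at \<zeta>0"
    using A(1) UV(1,3) holomorphic_deriv holomorphic_on_imp_differentiable_at
      field_differentiable_imp_differentiable by metis+
  have dF: "deriv F differentiable at \<zeta>0"
    using analytic_deriv[OF F_analytic] zeta_u_domain_imp_zeta_domain[OF N(2)]
      analytic_on_imp_differentiable_at field_differentiable_imp_differentiable by blast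

  define h where "h \<zeta> = exp (A \<zeta> - cnj (A \<zeta>)) * cnj (deriv A \<zeta>)" for \<zeta>
  have "h differentiable at \<zeta>0"
    unfolding h_def
    by (intro differentiable_mult differentiable_complex_exp differentiable_diff differentiable_cnj dA)
  then obtain h' where h': "(h has_derivative h') (at \<zeta>0)"
    by (auto simp: differentiable_def)
  have alpha: "pp_alpha a q = h (fst q)" if "q \<in> S" for q
  proof -
    obtain \<zeta> u v where q: "q = (\<zeta>, u, v)" "\<zeta> \<in> U" "u \<in> V"
      using \<open>q \<in> S\<close> by (auto simp: S_def)
    have "deriv (\<lambda>z. a z u) \<zeta> = deriv A \<zeta>"
      using UV(1) q A(2) by (intro deriv_cong_ev eventually_mono[OF eventually_nhds_in_open[of U]]) auto
    with q A(2) show ?thesis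
      by (simp add: pp_alpha_def h_def)
  qed
  have fst': "(fst has_derivative fst) (at q)" for q :: event
    by (rule has_derivative_fst[OF has_derivative_ident])
  have h_fst: "((\<lambda>q. h (fst q)) has_derivative (\<lambda>X. h' (fst X))) (at (\<zeta>0, u0, v0))"
    using has_derivative_compose[OF fst', of h h' "(\<zeta>0, u0, v0)"] h' by simp
  have d_alpha: "ext_d (pp_alpha a) (\<zeta>0, u0, v0) = (\<lambda>X. h' (fst X))"
    by (rule ext_d_eqI[OF S h_fst alpha])
  have d_alpha_cnj: "ext_d (\<lambda>q. cnj (pp_alpha a q)) (\<zeta>0, u0, v0) = (\<lambda>X. cnj (h' (fst X)))"
    by (rule ext_d_eqI[OF S has_derivative_cnj[OF h_fst]]) (simp add: alpha)

  define E where "E \<zeta> = exp (- A \<zeta> - 3 * cnj (A \<zeta>))" for \<zeta>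
  have "E differentiable at \<zeta>0"
    unfolding E_def
    by (intro differentiable_mult differentiable_complex_exp differentiable_diff differentiable_minus
        differentiable_const differentiable_cnj dA)
  then obtain E' where E': "(E has_derivative E') (at \<zeta>0)"
    by (auto simp: differentiable_def)
  obtain G where G: "(deriv F has_derivative G) (at \<zeta>0)"
    using dF by (auto simp: differentiable_def)
  have E_fst: "((\<lambda>q. E (fst q)) has_derivative (\<lambda>X. E' (fst X))) (at (\<zeta>0, u0, v0))"
    using has_derivative_compose[OF fst', of E E' "(\<zeta>0, u0, v0)"] E' by simp
  have G_fst: "((\<lambda>q. deriv F (fst q)) has_derivative (\<lambda>X. G (fst X))) (at (\<zeta>0, u0, v0))"
    using has_derivative_compose[OF fst', of "deriv F" G "(\<zeta>0, u0, v0)"] G by simp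
  have u': "((\<lambda>q :: event. fst (snd q)) has_derivative (\<lambda>X. fst (snd X))) (at q)" for q
    by (intro has_derivative_fst has_derivative_snd has_derivative_ident)
  have g_u: "((\<lambda>q :: event. g (fst (snd q))) has_derivative (\<lambda>X. fst (snd X) *\<^sub>R g'))
      (at (\<zeta>0, u0, v0))"
    using has_derivative_compose[OF u', of g "\<lambda>x. x *\<^sub>R g'" "(\<zeta>0, u0, v0)"] g'
    by (simp add: has_vector_derivative_def)
  \<comment> \<open>The \<zeta>-part of the differential of \<nu>, by the product rule with
    \<open>g\<close> frozen at \<open>u0\<close>.\<close>
  define m where "m z = E \<zeta>0 * cnj (G z) + E' z * cnj (deriv F \<zeta>0 + g u0)" for z
  have d_nu: "ext_d (pp_nu f a Z) (\<zeta>0, u0, v0) =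
      (\<lambda>X. E \<zeta>0 * cnj (G (fst X) + fst (snd X) *\<^sub>R g') + E' (fst X) * cnj (deriv F \<zeta>0 + g u0))"
  proof (rule ext_d_eqI[OF S])
    show "((\<lambda>q :: event. E (fst q) * cnj (deriv F (fst q) + g (fst (snd q)))) has_derivative
        (\<lambda>X. E \<zeta>0 * cnj (G (fst X) + fst (snd X) *\<^sub>R g') + E' (fst X) * cnj (deriv F \<zeta>0 + g u0)))
        (at (\<zeta>0, u0, v0))"
      using has_derivative_mult[OF E_fst has_derivative_cnj[OF has_derivative_add[OF G_fst g_u]]]
      by simp
    show "pp_nu f a Z q = E (fst q) * cnj (deriv F (fst q) + g (fst (snd q)))" if "q \<in> S" for q
    proof -
      obtain \<zeta> u v where q: "q = (\<zeta>, u, v)" "\<zeta> \<in> U" "u \<in> V"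
        using \<open>q \<in> S\<close> by (auto simp: S_def)
      then have "f_zeta f \<zeta> u = deriv F \<zeta> + g u"
        using UV(5) by (intro fz(1)) auto
      with q Z show ?thesis
        by (simp add: pp_nu_def E_def A(2))
    qed
  qed
  show thesis
  proof (rule that)
    show "linear h'"
      using h' by (rule has_derivative_linear)
    then show "linear (\<lambda>z. cnj (h' z))"
      by (auto intro!: linearI simp: linear_add linear_scale)
    have "linear G" "linear E'"
      using G E' by (auto intro: has_derivative_linear)
    then show "linear m"
      by (auto intro!: linearI simp: m_def linear_add linear_scale algebra_simps)
    show "E \<zeta>0 \<noteq> 0"
      by (simp add: E_def)
    show "ext_d (pp_nu f a Z) (\<zeta>0, u0, v0) X
        = m (fst X) + of_real (fst (snd X)) * (E \<zeta>0 * cnj g')" for X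
      by (simp add: d_nu m_def scaleR_conv_of_real algebra_simps)
  qed (use d_alpha d_alpha_cnj Z UV in auto)
qed

section \<open>The conditions compared event by event\<close>

theorem proposition6p8:
  fixes M :: "event set"
    and f a Z :: "complex \<Rightarrow> real \<Rightarrow> complex"
    and F :: "complex \<Rightarrow> complex"
    and g :: "real \<Rightarrow> complex"
  assumes pp_wave: "vacuum_pp_wave M f"
    and F_analytic: "F analytic_on zeta_domain M"
    and f_eq: "\<And>\<zeta> u. (\<zeta>, u) \<in> zeta_u_domain M \<Longrightarrow> f \<zeta> u = F \<zeta> + g u * \<zeta>"
    and a_branch: "quarter_log_branch M f a"
    and alpha_nz: "\<And>p. p \<in> M \<Longrightarrow> pp_alpha a p \<noteq> 0"
    and Z_inv: "zeta_inversion M a Z"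
    and type02: "type_0_2 M a"
  shows "((\<forall>p\<in>M. \<forall>X Y W. wedge3 (ext_d (pp_alpha a)) (ext_d (\<lambda>q. cnj (pp_alpha a q)))
                           (ext_d (pp_nu f a Z)) p X Y W = 0)
          \<longleftrightarrow> (\<forall>p\<in>M. NP_Delta f a Z (pp_nu f a Z) p = 0)) \<and>
         ((\<forall>p\<in>M. NP_Delta f a Z (pp_nu f a Z) p = 0)
          \<longleftrightarrow> (\<forall>u\<in>u_domain M. (g has_vector_derivative 0) (at u)))"
proof -
  let ?w = "wedge3 (ext_d (pp_alpha a)) (ext_d (\<lambda>q. cnj (pp_alpha a q))) (ext_d (pp_nu f a Z))"
  have M: "open M" and smooth: "smooth_on (\<lambda>(\<zeta>, u). f \<zeta> u) (zeta_u_domain M)"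
    using pp_wave by (auto simp: vacuum_pp_wave_def)
  have g': "\<exists>g'. (g has_vector_derivative g') (at u)" if "(\<zeta>, u, v) \<in> M" for \<zeta> u v
  proof -
    from that have "(\<zeta>, u) \<in> zeta_u_domain M"
      by (force simp: zeta_u_domain_def)
    then obtain U V where UV: "open U" "open V" "\<zeta> \<in> U" "u \<in> V" "U \<times> V \<subseteq> zeta_u_domain M"
      using zeta_u_domain_box[OF M] by blast
    \<comment> \<open>At \<open>\<zeta> = 0\<close> the function \<open>g\<close> cannot be recovered from \<open>f\<close>, so move to a nearby point.\<close>
    have "U \<noteq> {0}" "U \<noteq> {}"
      using UV(1,3) not_open_singleton[of "0 :: complex"] by auto
    then obtain \<zeta>' where \<zeta>': "\<zeta>' \<in> U" "\<zeta>' \<noteq> 0"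
      by blast
    have "Ck_on 1 (\<lambda>(\<zeta>, u). f \<zeta> u) (zeta_u_domain M)"
      using smooth by (simp add: smooth_on_def)
    then have "(\<lambda>(\<zeta>, u). f \<zeta> u) differentiable at (\<zeta>', u)"
      using UV \<zeta>' by auto
    then show ?thesis
      by (rule shear_vector_derivative[OF _ UV(2,4) \<zeta>'(2)]) (use UV(5) \<zeta>'(1) f_eq in auto)
  qed
  have pointwise: "(\<forall>X Y W. ?w (\<zeta>, u, v) X Y W = 0) \<longleftrightarrow> (g has_vector_derivative 0) (at u)"
    "NP_Delta f a Z (pp_nu f a Z) (\<zeta>, u, v) = 0 \<longleftrightarrow> (g has_vector_derivative 0) (at u)"
    if p: "(\<zeta>, u, v) \<in> M" for \<zeta> u v
  proof -
    obtain g' where g': "(g has_vector_derivative g') (at u)"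
      using g'[OF p] by blast
    \<comment> \<open>Uniqueness of the derivative reduces both equivalences to the algebraic
      condition \<open>g' = 0\<close>.\<close>
    have g'_iff: "(g has_vector_derivative 0) (at u) \<longleftrightarrow> g' = 0"
      using g' vector_derivative_unique_at by blast
    obtain h k m c where lin: "linear h" "linear k" "linear m" and c: "c \<noteq> 0"
      and d: "\<And>X. ext_d (pp_alpha a) (\<zeta>, u, v) X = h (fst X)"
        "\<And>X. ext_d (\<lambda>q. cnj (pp_alpha a q)) (\<zeta>, u, v) X = k (fst X)"
      and d_nu: "\<And>X. ext_d (pp_nu f a Z) (\<zeta>, u, v) X
           = m (fst X) + of_real (fst (snd X)) * (c * cnj g')"
      and Z: "Z_u Z (a \<zeta> u) u = 0"
      by (rule pp_wave_pointwise[OF pp_wave F_analytic f_eq a_branch Z_inv p g'], assumption)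
        (rule that, assumption+)
    show "NP_Delta f a Z (pp_nu f a Z) (\<zeta>, u, v) = 0 \<longleftrightarrow> (g has_vector_derivative 0) (at u)"
      \<comment> \<open>As \<open>Z_u\<close> vanishes, the vector \<Delta> has no
        \<zeta>-component, and its \<open>u\<close>-component is a positive exponential; what
        remains is a nonzero multiple of \<open>cnj g'\<close>.\<close>
      using lin c by (simp add: NP_Delta_def Delta_vector_eq Z d_nu g'_iff linear_0)
    show "(\<forall>X Y W. ?w (\<zeta>, u, v) X Y W = 0) \<longleftrightarrow> (g has_vector_derivative 0) (at u)"
    proof
      assume w: "\<forall>X Y W. ?w (\<zeta>, u, v) X Y W = 0"
      obtain X Y where XY:
        "wedge2 (ext_d (pp_alpha a)) (ext_d (\<lambda>q. cnj (pp_alpha a q))) (\<zeta>, u, v) X Y \<noteq> 0"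
        using type02 p by (auto simp: type_0_2_def)
      \<comment> \<open>The coordinate vector along \<open>u\<close> is annihilated by the
        differentials of \<alpha> and its conjugate, so only the term \<open>wedge2\<close> on
        \<open>X\<close>, \<open>Y\<close> times \<open>c * cnj g'\<close> survives.\<close>
      have "?w (\<zeta>, u, v) X Y (0, 1, 0) = 0"
        using w by blast
      with XY lin c show "(g has_vector_derivative 0) (at u)"
        by (simp add: wedge3_def wedge2_def d d_nu linear_0 g'_iff)
    next
      assume "(g has_vector_derivative 0) (at u)"
      then have "g' = 0"
        by (simp add: g'_iff)
      then show "\<forall>X Y W. ?w (\<zeta>, u, v) X Y W = 0"
        using wedge3_linear_complex[OF lin] d d_nu by simp
    qed
  qed
  \<comment> \<open>Each \<open>u\<close> in \<open>u_domain M\<close> comes from some event of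
    \<open>M\<close>, so the pointwise equivalences pass to the quantified ones.\<close>
  have "(\<forall>p\<in>M. P p) \<longleftrightarrow> (\<forall>u\<in>u_domain M. (g has_vector_derivative 0) (at u))"
    if "\<And>\<zeta> u v. (\<zeta>, u, v) \<in> M \<Longrightarrow> P (\<zeta>, u, v) \<longleftrightarrow> (g has_vector_derivative 0) (at u)" for P
    using that by (force simp: u_domain_def)
  note this[OF pointwise(1)] this[OF pointwise(2)]
  then show ?thesis
    by (simp only: simp_thms)
qed

end
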